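(* Let $0\le \mu<L<\infty$, $q=\mu/L$, let $f:\mathbb{R}^n\to\mathbb{R}$ belong to $\mathcal{F}_{\mu,L}(\mathbb{R}^n)$, and let $f_\star=\min_{x\in\mathbb{R}^n}f(x)$ (assumed attained). Let $k\ge 0$, and let $(x_k,d_k)$ and $(x_{k+1},d_{k+1})$ in $\mathbb{R}^n\times\mathbb{R}^n$ be generated by respectively $k$ and $k+1$ iterations of the Polak-Ribière-Polyak (PRP) nonlinear conjugate gradient method with exact line search. Then $$f(x_{k+1})-f_\star\le\left(\frac{1-q^2}{1+q^2}\right)^2\left(f(x_k)-f_\star\right).$$
   Context: $\mathcal{F}_{\mu,L}(\mathbb{R}^n)$ (for $0\le\mu<L<\infty$) is the class of differentiable (closed, proper) convex functions $f:\mathbb{R}^n\to\mathbb{R}$ that are $L$-smooth, i.e. $\|\nabla f(x)-\nabla f(y)\|\le L\|x-y\|$ for all $x,y$, and $\mu$-strongly convex, i.e. $f(x)\ge f(y)+\langle\nabla f(y);x-y\rangle+\frac{\mu}{2}\|x-y\|^2$ for all $x,y$. Here $\langle\cdot;\cdot\rangle$ and $\|\cdot\|$ are the Euclidean inner product and norm. The PRP method with exact line search starts from $x_0\in\mathbb{R}^n$ with $d_0=\nabla f(x_0)$ and iterates, for $k=0,1,2,\dots$: $\gamma_k\in\operatorname{argmin}_{\gamma\in\mathbb{R}}f(x_k-\gamma d_k)$; $x_{k+1}=x_k-\gamma_kd_k$; $\beta_k=\dfrac{\|\nabla f(x_{k+1})\|^2-\langle\nabla f(x_{k+1});\nabla f(x_k)\rangle}{\|\nabla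 f(x_k)\|^2}$; $d_{k+1}=\nabla f(x_{k+1})+\beta_kd_k$. It is understood that $\nabla f(x_j)\ne0$ whenever $\beta_j$ is formed, so that all quantities are well defined. *)

theory Defs
  imports "HOL-Analysis.Analysis"
begin

(* Meaningful only where f is differentiable; see GDERIV_grad below. *)
definition grad :: "('a::euclidean_space \<Rightarrow> real) \<Rightarrow> 'a \<Rightarrow> 'a" where
  "grad f x = (THE D. GDERIV f x :> D)"

lemma GDERIV_unique:
  assumes "GDERIV f x :> D" "GDERIV f x :> E"
  shows "D = E"
proof -
  have "(\<lambda>h. inner h D) = (\<lambda>h. inner h E)"
    using assms unfolding gderiv_def by (rule has_derivative_unique)
  then have "inner (D - E) D = inner (D - E) E"
    by metis
  then have "inner (D - E) (D - E) = 0"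
    by (simp add: inner_diff_right)
  then show ?thesis by simp
qed

lemma grad_eqI: "GDERIV f x :> D \<Longrightarrow> grad f x = D"
  unfolding grad_def by (blast intro: GDERIV_unique)

lemma GDERIV_grad:
  fixes f :: "'a::euclidean_space \<Rightarrow> real"
  assumes "f differentiable (at x)"
  shows "GDERIV f x :> grad f x"
proof -
  obtain f' where f': "(f has_derivative f') (at x)"
    using assms by (auto simp: differentiable_def)
  then have "linear f'"
    by (rule has_derivative_linear)
  then have "f' = (\<lambda>h. inner h (adjoint f' 1))"
    by (auto simp: adjoint_works fun_eq_iff)
  then have "GDERIV f x :> adjoint f' 1"
    using f' unfolding gderiv_def by simp
  then show ?thesis by (metis grad_eqI)
qed

(* Properness and closedness need no clause: f is real-valued on the whole
   space and differentiable, hence continuous. *)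
definition smooth_strongly_convex :: "real \<Rightarrow> real \<Rightarrow> ('a::euclidean_space \<Rightarrow> real) set"
  where
  "smooth_strongly_convex \<mu> L = {f.
     f differentiable_on UNIV \<and>
     convex_on UNIV f \<and>
     L-lipschitz_on UNIV (grad f) \<and>
     (\<forall>x y. f x \<ge> f y + inner (grad f y) (x - y) + \<mu> / 2 * (norm (x - y))\<^sup>2)}"

(* The first N iterations of the method; the sequences are unconstrained beyond
   x N and d N. Line-search minimisers need not be unique, so the step sizes are
   part of the data. Each iteration j < N forms \<beta> j, hence the requirement that
   the gradient at x j does not vanish. *)
definition prp_exact_line_search ::
  "('a::euclidean_space \<Rightarrow> real) \<Rightarrow> nat \<Rightarrow> (nat \<Rightarrow> 'a) \<Rightarrow> (nat \<Rightarrow> 'a)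
    \<Rightarrow> (nat \<Rightarrow> real) \<Rightarrow> (nat \<Rightarrow> real) \<Rightarrow> bool" where
  "prp_exact_line_search f N x d \<gamma> \<beta> \<longleftrightarrow>
     d 0 = grad f (x 0) \<and>
     (\<forall>j<N.
        is_arg_min (\<lambda>t. f (x j - t *\<^sub>R d j)) (\<lambda>_. True) (\<gamma> j) \<and>
        x (Suc j) = x j - \<gamma> j *\<^sub>R d j \<and>
        grad f (x j) \<noteq> 0 \<and>
        \<beta> j = ((norm (grad f (x (Suc j))))\<^sup>2 - inner (grad f (x (Suc j))) (grad f (x j)))
                / (norm (grad f (x j)))\<^sup>2 \<and>
        d (Suc j) = grad f (x (Suc j)) + \<beta> j *\<^sub>R d j)"

end

theory Submission
  imports Defs
begin

text \<open>
  Write \<open>g\<^sub>k\<close> for the gradient at \<open>x k\<close>. The argument never looks back further than one step: it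
  bounds the angle between the search direction and the gradient, and then treats the step as
  a gradient step with an inexact direction. Suppose first that \<open>\<mu> > 0\<close>.

  \<^bold>\<open>Angle.\<close> Exact line search makes \<open>g\<^sub>k\<^sub>+\<^sub>1\<close> orthogonal to \<open>d k\<close>, so \<open>d k\<close> and \<open>g\<^sub>k\<close> have inner product
  \<open>(norm g\<^sub>k)\<^sup>2\<close>, and the size of \<open>\<beta> k *\<^sub>R d k\<close> relative to \<open>g\<^sub>k\<^sub>+\<^sub>1\<close> is governed by the tangent of the angle
  between \<open>x k - x (Suc k)\<close> and \<open>g\<^sub>k - g\<^sub>k\<^sub>+\<^sub>1\<close>. Cocoercivity of the gradient bounds this tangent by
  \<open>(L - \<mu>) / (2 * sqrt (\<mu> * L))\<close> (\<open>cocoercive_tangent_bound\<close>). It follows that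
  \<open>norm (d k) / norm g\<^sub>k\<close> is at most \<open>(L + \<mu>) / (2 * sqrt (\<mu> * L))\<close> (\<open>prp_direction_norm_bound\<close>), that
  is, the sine of the angle between \<open>d k\<close> and \<open>g\<^sub>k\<close> is at most \<open>\<epsilon> = (L - \<mu>) / (L + \<mu>)\<close>. Since \<open>g\<^sub>k\<^sub>+\<^sub>1\<close>
  is orthogonal to \<open>d k\<close>, only the component of \<open>g\<^sub>k\<close> orthogonal to \<open>d k\<close> contributes to the inner
  product of the two gradients, which is therefore at most \<open>\<epsilon> * norm g\<^sub>k * norm g\<^sub>k\<^sub>+\<^sub>1\<close>
  (\<open>prp_consecutive_gradients_angle\<close>).

  \<^bold>\<open>Decrease.\<close> An exact line search with such an \<open>\<epsilon>\<close> contracts the objective gap by \<open>\<rho>\<^sup>2\<close>, where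
  \<open>\<rho> = ((1 + \<epsilon>) * L - (1 - \<epsilon>) * \<mu>) / ((1 + \<epsilon>) * L + (1 - \<epsilon>) * \<mu>)\<close> (\<open>line_search_contraction\<close>): this is
  the rate of exact gradient descent with \<open>L\<close> inflated to \<open>(1 + \<epsilon>) * L\<close> and \<open>\<mu>\<close> deflated to
  \<open>(1 - \<epsilon>) * \<mu>\<close>. For the above \<open>\<epsilon>\<close> these two constants are in the ratio \<open>L\<^sup>2\<close> to \<open>\<mu>\<^sup>2\<close>, so \<open>\<rho>\<close> becomes
  \<open>(1 - q\<^sup>2) / (1 + q\<^sup>2)\<close>. When \<open>\<mu> = 0\<close> the claimed factor is 1 and the line search alone suffices.
\<close>

section \<open>Smooth strongly convex functions\<close>

lemma smooth_strongly_convex_GDERIV: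
  assumes "f \<in> smooth_strongly_convex \<mu> L"
  shows "GDERIV f x :> grad f x"
  using assms by (intro GDERIV_grad) (auto simp: smooth_strongly_convex_def differentiable_on_def)

lemma GDERIV_along_line:
  assumes "GDERIV f (x + t *\<^sub>R v) :> g"
  shows "((\<lambda>s. f (x + s *\<^sub>R v)) has_real_derivative inner g v) (at t)"
proof -
  have line: "((\<lambda>s. x + s *\<^sub>R v) has_derivative (\<lambda>h. h *\<^sub>R v)) (at t)"
    by (auto intro!: derivative_eq_intros)
  have "((\<lambda>s. f (x + s *\<^sub>R v)) has_derivative (\<lambda>h. inner (h *\<^sub>R v) g)) (at t)"
    using has_derivative_compose[OF line, of f "\<lambda>h. inner h g"] assms
    by (simp add: gderiv_def)
  then show ?thesis
    by (simp add: has_field_derivative_def inner_commute mult_commute_abs)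
qed

lemma descent_lemma:
  assumes "f \<in> smooth_strongly_convex \<mu> L"
  shows "f y \<le> f x + inner (grad f x) (y - x) + L / 2 * (norm (y - x))\<^sup>2"
proof -
  define v where "v = y - x"
  define \<phi> where "\<phi> t = f (x + t *\<^sub>R v) - t * inner (grad f x) v - L / 2 * t\<^sup>2 * (norm v)\<^sup>2" for t
  have "\<phi> 1 \<le> \<phi> 0"
  proof (rule DERIV_nonpos_imp_nonincreasing[where f = \<phi>])
    fix t :: real assume "0 \<le> t" "t \<le> 1"
    let ?D = "inner (grad f (x + t *\<^sub>R v)) v - inner (grad f x) v - L * t * (norm v)\<^sup>2"
    have "(\<phi> has_real_derivative ?D) (at t)"
      unfolding \<phi>_def
      by (auto intro!: derivative_eq_intros GDERIV_along_line smooth_strongly_convex_GDERIV[OF assms])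
    moreover have "?D \<le> 0"
    proof -
      have "dist (grad f (x + t *\<^sub>R v)) (grad f x) \<le> L * dist (x + t *\<^sub>R v) x"
        using assms by (auto simp: smooth_strongly_convex_def intro: lipschitz_onD)
      then have "norm (grad f (x + t *\<^sub>R v) - grad f x) \<le> L * (t * norm v)"
        using \<open>0 \<le> t\<close> by (simp add: dist_norm)
      then have "norm (grad f (x + t *\<^sub>R v) - grad f x) * norm v \<le> L * (t * norm v) * norm v"
        by (rule mult_right_mono) simp
      moreover have "inner (grad f (x + t *\<^sub>R v) - grad f x) v
          \<le> norm (grad f (x + t *\<^sub>R v) - grad f x) * norm v"
        by (rule norm_cauchy_schwarz)
      ultimately show ?thesis
        by (simp add: inner_diff_left power2_eq_square algebra_simps)
    qed
    ultimately show "\<exists>D. (\<phi> has_real_derivative D) (at t) \<and> D \<le> 0" by blast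
  qed simp
  then show ?thesis by (simp add: \<phi>_def v_def)
qed

text \<open>
  The lower quadratic bound at \<open>y\<close> and the upper quadratic bound at \<open>x\<close> both hold at every third
  point \<open>z\<close>, and comparing them gives a lower bound on \<open>f x - f y\<close> for each \<open>z\<close>. The choice
  \<open>z = x + h\<close> in the proof makes that bound as large as possible. On the right, the last norm measures the
  distance between the results of one gradient step of length \<open>1 / L\<close> from \<open>x\<close> and from \<open>y\<close>; with
  this grouping the quadratic forms that occur later decouple.
\<close>

lemma interpolation_inequality:
  assumes f: "f \<in> smooth_strongly_convex \<mu> L" and "0 \<le> \<mu>" "\<mu> < L"
  shows "f x \<ge> f y + inner (grad f y) (x - y) + (norm (grad f x - grad f y))\<^sup>2 / (2 * L)
    + \<mu> * L / (2 * (L - \<mu>)) * (norm ((x - y) - (grad f x - grad f y) /\<^sub>R L))\<^sup>2"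
proof -
  define u where "u = x - y"
  define v where "v = grad f x - grad f y"
  define h where "h = (\<mu> *\<^sub>R u - v) /\<^sub>R (L - \<mu>)"
  have pos: "0 < L" "0 < L - \<mu>" using assms by auto
  have vh: "v = \<mu> *\<^sub>R u - (L - \<mu>) *\<^sub>R h"
    using pos by (simp add: h_def)
  have "f (x + h) \<ge> f y + inner (grad f y) (u + h) + \<mu> / 2 * (norm (u + h))\<^sup>2"
  proof -
    have "(x + h) - y = u + h" by (simp add: u_def)
    then show ?thesis using f unfolding smooth_strongly_convex_def by (metis (mono_tags, lifting) mem_Collect_eq)
  qed
  moreover have "f (x + h) \<le> f x + inner (grad f x) h + L / 2 * (norm h)\<^sup>2"
    using descent_lemma[OF f, of "x + h" x] by simp
  moreover have "inner (grad f x) h = inner (grad f y) h + inner v h"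
    by (simp add: v_def inner_diff_left)
  ultimately have "f x \<ge> f y + inner (grad f y) u
      + (\<mu> / 2 * (norm (u + h))\<^sup>2 - inner v h - L / 2 * (norm h)\<^sup>2)"
    by (simp add: inner_add_right)
  moreover have "\<mu> / 2 * (norm (u + h))\<^sup>2 - inner v h - L / 2 * (norm h)\<^sup>2
      = (norm v)\<^sup>2 / (2 * L) + \<mu> * L / (2 * (L - \<mu>)) * (norm (u - v /\<^sub>R L))\<^sup>2"
  proof -
    have "u - v /\<^sub>R L = ((L - \<mu>) / L) *\<^sub>R (u + h)"
      using pos by (simp add: vh algebra_simps diff_divide_distrib) (simp add: divide_inverse)
    then have "norm (u - v /\<^sub>R L) = (L - \<mu>) / L * norm (u + h)"
      using pos by simp
    then have "\<mu> * L / (2 * (L - \<mu>)) * (norm (u - v /\<^sub>R L))\<^sup>2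
        = \<mu> * (L - \<mu>) / (2 * L) * (norm (u + h))\<^sup>2"
      using pos by (simp only:) (simp add: field_simps power2_eq_square)
    then show ?thesis
      unfolding vh power2_norm_eq_inner
      using pos by (simp add: inner_simps inner_commute field_simps power2_eq_square)
  qed
  ultimately show ?thesis by (simp add: u_def v_def)
qed

text \<open>
  The sum of the two interpolation inequalities obtained by exchanging \<open>x\<close> and \<open>y\<close>, multiplied by
  \<open>L - \<mu>\<close>. Geometrically, the change of gradient lies in the ball that has the segment from
  \<open>\<mu> *\<^sub>R (x - y)\<close> to \<open>L *\<^sub>R (x - y)\<close> as a diameter.
\<close>

lemma cocoercivity:
  assumes f: "f \<in> smooth_strongly_convex \<mu> L" and "0 \<le> \<mu>" "\<mu> < L"
  shows "(norm (grad f x - grad f y))\<^sup>2 + \<mu> * L * (norm (x - y))\<^sup>2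
    \<le> (L + \<mu>) * inner (x - y) (grad f x - grad f y)"
proof -
  define u where "u = x - y"
  define v where "v = grad f x - grad f y"
  have pos: "0 < L" "0 < L - \<mu>" using assms by auto
  have swap: "(y - x) - (grad f y - grad f x) /\<^sub>R L = - (u - v /\<^sub>R L)"
    by (simp add: u_def v_def algebra_simps)
  have "inner u v \<ge> (norm v)\<^sup>2 / L + \<mu> * L / (L - \<mu>) * (norm (u - v /\<^sub>R L))\<^sup>2"
  proof -
    define A where "A = (norm v)\<^sup>2 / (2 * L)"
    define B where "B = \<mu> * L / (2 * (L - \<mu>)) * (norm (u - v /\<^sub>R L))\<^sup>2"
    have "f x \<ge> f y + inner (grad f y) u + A + B"
      using interpolation_inequality[OF assms, of y x] by (simp add: A_def B_def u_def v_def)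
    moreover have "f y \<ge> f x - inner (grad f x) u + A + B"
      using interpolation_inequality[OF assms, of x y]
      unfolding swap norm_minus_cancel norm_minus_commute[of "grad f y"]
      by (simp add: A_def B_def u_def v_def inner_diff_right)
    ultimately have "inner u v \<ge> 2 * A + 2 * B"
      by (simp add: v_def inner_diff_right inner_commute)
    moreover have "2 * A = (norm v)\<^sup>2 / L" by (simp add: A_def)
    moreover have "2 * B = \<mu> * L / (L - \<mu>) * (norm (u - v /\<^sub>R L))\<^sup>2"
      using pos by (simp add: B_def field_simps)
    ultimately show ?thesis by simp
  qed
  moreover have "(norm v)\<^sup>2 / L + \<mu> * L / (L - \<mu>) * (norm (u - v /\<^sub>R L))\<^sup>2
      = ((norm v)\<^sup>2 + \<mu> * L * (norm u)\<^sup>2 - 2 * \<mu> * inner u v) / (L - \<mu>)"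
    unfolding power2_norm_eq_inner
    using pos by (simp add: inner_simps inner_commute field_simps power2_eq_square)
  ultimately have "((norm v)\<^sup>2 + \<mu> * L * (norm u)\<^sup>2 - 2 * \<mu> * inner u v) / (L - \<mu>) \<le> inner u v"
    by simp
  then have "(norm v)\<^sup>2 + \<mu> * L * (norm u)\<^sup>2 - 2 * \<mu> * inner u v \<le> inner u v * (L - \<mu>)"
    using pos by (simp add: pos_divide_le_eq)
  then show ?thesis
    by (simp add: u_def[symmetric] v_def[symmetric] algebra_simps)
qed

lemma grad_orthogonal_at_line_minimum:
  assumes f: "f \<in> smooth_strongly_convex \<mu> L"
    and "is_arg_min (\<lambda>t. f (x - t *\<^sub>R d)) (\<lambda>_. True) t"
  shows "inner (grad f (x - t *\<^sub>R d)) d = 0"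
proof -
  have "((\<lambda>s. f (x + s *\<^sub>R (- d))) has_real_derivative
      inner (grad f (x + t *\<^sub>R (- d))) (- d)) (at t)"
    by (intro GDERIV_along_line smooth_strongly_convex_GDERIV[OF f])
  then have "inner (grad f (x + t *\<^sub>R (- d))) (- d) = 0"
    using assms(2) by (rule_tac DERIV_local_min[of _ _ t 1]) (auto simp: is_arg_min_linorder)
  then show ?thesis by simp
qed

lemma grad_zero_at_minimum:
  assumes f: "f \<in> smooth_strongly_convex \<mu> L" and "is_arg_min f (\<lambda>_. True) x"
  shows "grad f x = 0"
  using grad_orthogonal_at_line_minimum[OF f, of x "grad f x" 0] assms(2)
  by (simp add: is_arg_min_linorder)

section \<open>Exact line search along an inexact gradient direction\<close>

text \<open>
  The line search enters only through the orthogonality of the new gradient to the step, and the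
  quality of the direction only through the angle between consecutive gradients.

  With \<open>a\<close>, \<open>b\<close> the gradients at \<open>x\<close>, \<open>y\<close>, the interpolation inequalities for the pairs
  \<open>(x, y)\<close>, \<open>(z, x)\<close> and \<open>(z, y)\<close> are added with weights \<open>\<rho>\<close>, \<open>\<rho> * (1 - \<rho>)\<close> and \<open>1 - \<rho>\<close>; these weights
  leave exactly \<open>\<rho>\<^sup>2 * (f x - f z) - (f y - f z)\<close> of the function values. What remains is a quadratic
  form in \<open>a\<close>, \<open>b\<close> and the vectors \<open>v\<close>, \<open>w\<close>, the positions relative to \<open>z\<close> after a gradient step of
  length \<open>1 / L\<close> from \<open>x\<close>, \<open>y\<close>. Completing squares in \<open>w\<close> and then in \<open>v\<close> leaves a form in the
  gradients alone, and for the given \<open>\<rho>\<close> it is a positive multiple of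
  \<open>\<epsilon> * (\<rho>\<^sup>2 * (norm a)\<^sup>2 + (norm b)\<^sup>2) - 2 * \<rho> * inner a b\<close>. This is nonnegative by the angle
  hypothesis and the inequality between arithmetic and geometric means.
\<close>

lemma line_search_contraction:
  fixes f :: "'a::euclidean_space \<Rightarrow> real"
  assumes f: "f \<in> smooth_strongly_convex \<mu> L" and "0 < \<mu>" "\<mu> < L"
    and min: "is_arg_min f (\<lambda>_. True) z"
    and \<epsilon>: "0 \<le> \<epsilon>" "\<epsilon> \<le> 1"
    and orth: "inner (grad f y) (x - y) = 0"
    and angle: "inner (grad f x) (grad f y) \<le> \<epsilon> * norm (grad f x) * norm (grad f y)"
    and \<rho>: "\<rho> = ((1 + \<epsilon>) * L - (1 - \<epsilon>) * \<mu>) / ((1 + \<epsilon>) * L + (1 - \<epsilon>) * \<mu>)"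
  shows "f y - f z \<le> \<rho>\<^sup>2 * (f x - f z)"
proof -
  define a where "a = grad f x"
  define b where "b = grad f y"
  define v where "v = (x - z) - a /\<^sub>R L"
  define w where "w = (y - z) - b /\<^sub>R L"
  define C where "C = \<mu> * L / (2 * (L - \<mu>))"
  define D where "D = (1 + \<epsilon>) * L - (1 - \<epsilon>) * \<mu>"
  define S where "S = (1 + \<epsilon>) * L + (1 - \<epsilon>) * \<mu>"
  have L: "0 < L" "\<mu> < L" using assms by auto
  have "D = (L - \<mu>) + \<epsilon> * (L + \<mu>)" by (simp add: D_def algebra_simps)
  then have D: "0 < D" using \<epsilon> \<open>0 < \<mu>\<close> L by (simp add: add_pos_nonneg)
  have "0 \<le> (1 - \<epsilon>) * \<mu>" using \<epsilon> \<open>0 < \<mu>\<close> by simp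
  then have S: "0 < S" "D \<le> S" using D by (auto simp: D_def S_def)
  have \<rho>_DS: "\<rho> = D / S" by (simp add: \<rho> D_def S_def)
  then have \<rho>_pos: "0 < \<rho>" "\<rho> \<le> 1" using D S by auto
  have C: "0 < C" using assms L by (simp add: C_def)
  have gz: "grad f z = 0" by (rule grad_zero_at_minimum[OF f min])
  note interp = interpolation_inequality[OF f less_imp_le[OF \<open>0 < \<mu>\<close>] \<open>\<mu> < L\<close>]
  have xy: "f x \<ge> f y + (norm (a - b))\<^sup>2 / (2 * L) + C * (norm (v - w))\<^sup>2"
  proof -
    have "(x - y) - (a - b) /\<^sub>R L = v - w" by (simp add: v_def w_def algebra_simps)
    then show ?thesis
      using interp[of y x] orth by (simp add: a_def b_def C_def)
  qed
  have zx: "f z \<ge> f x - inner a v - (norm a)\<^sup>2 / (2 * L) + C * (norm v)\<^sup>2"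
  proof -
    have "(z - x) - (0 - a) /\<^sub>R L = - v" by (simp add: v_def algebra_simps)
    moreover have "inner a (z - x) = - inner a v - (norm a)\<^sup>2 / L"
      using L by (simp add: v_def inner_simps power2_norm_eq_inner divide_inverse)
    moreover have "(norm a)\<^sup>2 / L = 2 * ((norm a)\<^sup>2 / (2 * L))" by simp
    ultimately show ?thesis
      using interp[of x z] by (simp add: gz a_def C_def)
  qed
  have zy: "f z \<ge> f y - inner b v - inner a b / L + (norm b)\<^sup>2 / (2 * L) + C * (norm w)\<^sup>2"
  proof -
    have "(z - y) - (0 - b) /\<^sub>R L = - w" by (simp add: w_def algebra_simps)
    moreover have "inner b (z - y) = - inner b v - inner a b / L"
      using orth by (simp add: v_def b_def inner_simps inner_commute divide_inverse)
    ultimately show ?thesis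
      using interp[of y z] by (simp add: gz b_def C_def)
  qed
  define N where "N = \<rho>\<^sup>2 * (norm a)\<^sup>2 + (norm b)\<^sup>2"
  have "\<rho>\<^sup>2 * (f x - f z) - (f y - f z)
      = \<rho> * (f x - f y) + \<rho> * (1 - \<rho>) * (f z - f x) + (1 - \<rho>) * (f z - f y)"
    by (simp add: algebra_simps power2_eq_square)
  also have "\<dots> \<ge> \<rho> * ((norm (a - b))\<^sup>2 / (2 * L) + C * (norm (v - w))\<^sup>2)
      + \<rho> * (1 - \<rho>) * (- inner a v - (norm a)\<^sup>2 / (2 * L) + C * (norm v)\<^sup>2)
      + (1 - \<rho>) * (- inner b v - inner a b / L + (norm b)\<^sup>2 / (2 * L) + C * (norm w)\<^sup>2)"
    using \<rho>_pos xy zx zy by (intro add_mono mult_left_mono) auto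
  also have "\<rho> * ((norm (a - b))\<^sup>2 / (2 * L) + C * (norm (v - w))\<^sup>2)
      + \<rho> * (1 - \<rho>) * (- inner a v - (norm a)\<^sup>2 / (2 * L) + C * (norm v)\<^sup>2)
      + (1 - \<rho>) * (- inner b v - inner a b / L + (norm b)\<^sup>2 / (2 * L) + C * (norm w)\<^sup>2)
    = (N - 2 * inner a b) / (2 * L) - (1 - \<rho>) / (8 * C * \<rho>) * (N + 2 * \<rho> * inner a b)
      + C * (norm (w - \<rho> *\<^sub>R v))\<^sup>2
      + (1 - \<rho>) / (8 * C * \<rho>) * (norm ((4 * C * \<rho>) *\<^sub>R v - (\<rho> *\<^sub>R a + b)))\<^sup>2"
    unfolding N_def power2_norm_eq_inner
    using L C \<rho>_pos by (simp add: inner_simps inner_commute field_simps power2_eq_square)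
  also have "\<dots> \<ge> (N - 2 * inner a b) / (2 * L) - (1 - \<rho>) / (8 * C * \<rho>) * (N + 2 * \<rho> * inner a b)"
    using C \<rho>_pos by simp
  also have "(N - 2 * inner a b) / (2 * L) - (1 - \<rho>) / (8 * C * \<rho>) * (N + 2 * \<rho> * inner a b)
      = (\<epsilon> * N - 2 * \<rho> * inner a b) / D"
  proof -
    have "(1 - \<rho>) / (8 * C * \<rho>) = (1 - \<epsilon>) * (L - \<mu>) / (2 * L * D)"
    proof -
      have "(1 - \<rho>) / \<rho> = 2 * (1 - \<epsilon>) * \<mu> / D"
        using D S by (simp add: \<rho>_DS field_simps) (simp add: D_def S_def algebra_simps)
      moreover have "1 / (8 * C) = (L - \<mu>) / (4 * \<mu> * L)"
        using \<open>0 < \<mu>\<close> L by (simp add: C_def field_simps)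
      ultimately have "(1 - \<rho>) / \<rho> * (1 / (8 * C))
          = 2 * (1 - \<epsilon>) * \<mu> / D * ((L - \<mu>) / (4 * \<mu> * L))" by simp
      also have "\<dots> = (1 - \<epsilon>) * (L - \<mu>) / (2 * L * D)"
        using \<open>0 < \<mu>\<close> L D by (simp add: divide_simps) (simp add: algebra_simps)
      finally show ?thesis by (simp add: mult_ac)
    qed
    moreover have "D + (1 - \<epsilon>) * (L - \<mu>) * \<rho> = 2 * L * \<rho>"
    proof -
      have "D = S * \<rho>" using S by (simp add: \<rho>_DS)
      then have "D + (1 - \<epsilon>) * (L - \<mu>) * \<rho> = (S + (1 - \<epsilon>) * (L - \<mu>)) * \<rho>"
        by (simp add: algebra_simps)
      also have "S + (1 - \<epsilon>) * (L - \<mu>) = 2 * L" by (simp add: S_def algebra_simps)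
      finally show ?thesis .
    qed
    moreover have "D - (1 - \<epsilon>) * (L - \<mu>) = 2 * L * \<epsilon>" by (simp add: D_def algebra_simps)
    moreover have "(N - 2 * inner a b) / (2 * L)
        - (1 - \<epsilon>) * (L - \<mu>) / (2 * L * D) * (N + 2 * \<rho> * inner a b)
      = ((D - (1 - \<epsilon>) * (L - \<mu>)) * N - 2 * (D + (1 - \<epsilon>) * (L - \<mu>) * \<rho>) * inner a b) / (2 * L * D)"
      using D L by (simp add: divide_simps) (simp add: algebra_simps)
    ultimately have "(N - 2 * inner a b) / (2 * L) - (1 - \<rho>) / (8 * C * \<rho>) * (N + 2 * \<rho> * inner a b)
        = (2 * L * \<epsilon> * N - 2 * (2 * L * \<rho>) * inner a b) / (2 * L * D)"
      by (simp only:)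
    also have "\<dots> = (2 * L * (\<epsilon> * N - 2 * \<rho> * inner a b)) / (2 * L * D)"
      by (simp add: algebra_simps)
    also have "\<dots> = (\<epsilon> * N - 2 * \<rho> * inner a b) / D"
      using L by simp
    finally show ?thesis .
  qed
  also have "\<dots> \<ge> 0"
  proof -
    have "2 * \<rho> * inner a b \<le> 2 * \<rho> * (\<epsilon> * norm a * norm b)"
      using angle \<rho>_pos by (intro mult_left_mono) (auto simp: a_def b_def)
    also have "\<dots> = \<epsilon> * (2 * (\<rho> * norm a) * norm b)" by simp
    also have "\<dots> \<le> \<epsilon> * ((\<rho> * norm a)\<^sup>2 + (norm b)\<^sup>2)"
      using \<epsilon> by (intro mult_left_mono sum_squares_bound)
    finally show ?thesis using D by (simp add: N_def power_mult_distrib)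
  qed
  finally show ?thesis by simp
qed

section \<open>The angle between the search direction and the gradient\<close>

text \<open>
  The Cauchy-Schwarz inequality for \<open>w\<close> and the component of \<open>v\<close> orthogonal to \<open>u\<close>, cleared of the
  denominator \<open>(norm u)\<^sup>2\<close>.
\<close>

lemma orthogonal_component_bound:
  fixes u v w :: "'a::real_inner"
  assumes "inner w u = 0"
  shows "(inner w v)\<^sup>2 * (norm u)\<^sup>2 \<le> (norm w)\<^sup>2 * ((norm u)\<^sup>2 * (norm v)\<^sup>2 - (inner u v)\<^sup>2)"
proof (cases "u = 0")
  case False
  define U where "U = (norm u)\<^sup>2"
  define E where "E = U * (norm v)\<^sup>2 - (inner u v)\<^sup>2"
  define r where "r = U *\<^sub>R v - inner u v *\<^sub>R u"
  have "U * inner w v = inner w r"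
    using assms by (simp add: r_def inner_simps)
  then have "(U * inner w v)\<^sup>2 \<le> (norm w)\<^sup>2 * (norm r)\<^sup>2"
    using Cauchy_Schwarz_ineq[of w r] by (simp add: power2_norm_eq_inner)
  moreover have "(norm r)\<^sup>2 = U * E"
    unfolding r_def E_def U_def power2_norm_eq_inner
    by (simp add: inner_simps inner_commute power2_eq_square algebra_simps)
  ultimately have "(U * inner w v)\<^sup>2 \<le> (norm w)\<^sup>2 * (U * E)" by (simp only:)
  then have "U * ((inner w v)\<^sup>2 * U) \<le> U * ((norm w)\<^sup>2 * E)"
    by (simp add: power2_eq_square mult_ac)
  then have "(inner w v)\<^sup>2 * U \<le> (norm w)\<^sup>2 * E"
    using False by (subst (asm) mult_le_cancel_left_pos) (auto simp: U_def)
  then show ?thesis by (simp add: U_def E_def)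
qed simp

text \<open>
  The cocoercivity hypothesis confines \<open>v\<close> to the ball with diameter from \<open>\<mu> *\<^sub>R u\<close> to \<open>L *\<^sub>R u\<close>. The
  tangent of the angle between \<open>u\<close> and a point of this ball is, for positive \<open>\<mu>\<close> and \<open>L\<close>, at most
  \<open>\<bar>L - \<mu>\<bar> / (2 * sqrt (\<mu> * L))\<close>, with equality where a line through the origin touches the ball; the square discarded in the proof
  vanishes there. The component of \<open>v\<close> along \<open>w\<close> is at most the component orthogonal to \<open>u\<close>.
\<close>

lemma cocoercive_tangent_bound:
  fixes u v w :: "'a::real_inner"
  assumes coco: "(norm v)\<^sup>2 + \<mu> * L * (norm u)\<^sup>2 \<le> (L + \<mu>) * inner u v"
    and "0 \<le> \<mu>" "0 \<le> L" and orth: "inner w u = 0"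
  shows "4 * \<mu> * L * (inner w v)\<^sup>2 * (norm u)\<^sup>2 \<le> (L - \<mu>)\<^sup>2 * (inner u v)\<^sup>2 * (norm w)\<^sup>2"
proof -
  define U where "U = (norm u)\<^sup>2"
  define s where "s = inner u v"
  have "U * (norm v)\<^sup>2 \<le> U * ((L + \<mu>) * s - \<mu> * L * U)"
    using coco by (intro mult_left_mono) (auto simp: U_def s_def)
  then have "4 * \<mu> * L * (U * (norm v)\<^sup>2 - s\<^sup>2) \<le> 4 * \<mu> * L * (U * ((L + \<mu>) * s - \<mu> * L * U) - s\<^sup>2)"
    using assms by (intro mult_left_mono) auto
  also have "\<dots> = (L - \<mu>)\<^sup>2 * s\<^sup>2 - ((L + \<mu>) * s - 2 * \<mu> * L * U)\<^sup>2"
    by (simp add: power2_eq_square algebra_simps)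
  also have "\<dots> \<le> (L - \<mu>)\<^sup>2 * s\<^sup>2" by simp
  finally have cone: "4 * \<mu> * L * (U * (norm v)\<^sup>2 - s\<^sup>2) \<le> (L - \<mu>)\<^sup>2 * s\<^sup>2" .
  have "4 * \<mu> * L * ((inner w v)\<^sup>2 * U) \<le> 4 * \<mu> * L * ((norm w)\<^sup>2 * (U * (norm v)\<^sup>2 - s\<^sup>2))"
    using orthogonal_component_bound[OF orth, of v] assms
    by (intro mult_left_mono) (auto simp: U_def s_def)
  also have "\<dots> \<le> (norm w)\<^sup>2 * ((L - \<mu>)\<^sup>2 * s\<^sup>2)"
    using mult_left_mono[OF cone, of "(norm w)\<^sup>2"] by (simp add: algebra_simps)
  finally show ?thesis by (simp add: U_def s_def algebra_simps)
qed

lemma prp_step: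
  assumes "prp_exact_line_search f N x d \<gamma> \<beta>" and "j < N"
  shows "is_arg_min (\<lambda>t. f (x j - t *\<^sub>R d j)) (\<lambda>_. True) (\<gamma> j)"
    and "x (Suc j) = x j - \<gamma> j *\<^sub>R d j"
    and "grad f (x j) \<noteq> 0"
    and "\<beta> j = ((norm (grad f (x (Suc j))))\<^sup>2 - inner (grad f (x (Suc j))) (grad f (x j)))
                / (norm (grad f (x j)))\<^sup>2"
    and "d (Suc j) = grad f (x (Suc j)) + \<beta> j *\<^sub>R d j"
  using assms by (auto simp: prp_exact_line_search_def)

lemma prp_grad_orthogonal_direction:
  assumes "f \<in> smooth_strongly_convex \<mu> L"
    and "prp_exact_line_search f N x d \<gamma> \<beta>" and "j < N"
  shows "inner (grad f (x (Suc j))) (d j) = 0"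
  using grad_orthogonal_at_line_minimum[OF assms(1) prp_step(1)[OF assms(2,3)]]
  by (simp add: prp_step(2)[OF assms(2,3)])

lemma prp_grad_inner_direction:
  assumes "f \<in> smooth_strongly_convex \<mu> L"
    and prp: "prp_exact_line_search f N x d \<gamma> \<beta>" and "j \<le> N"
  shows "inner (grad f (x j)) (d j) = (norm (grad f (x j)))\<^sup>2"
proof (cases j)
  case 0
  then show ?thesis using prp by (simp add: prp_exact_line_search_def power2_norm_eq_inner)
next
  case (Suc i)
  then have "i < N" using \<open>j \<le> N\<close> by simp
  then show ?thesis
    using prp_step(5)[OF prp, of i] prp_grad_orthogonal_direction[OF assms(1) prp, of i]
    by (simp add: Suc inner_add_right power2_norm_eq_inner)
qed

text \<open>
  For \<open>j = Suc i\<close> the two summands of \<open>d j\<close> are orthogonal, so only \<open>\<beta> i *\<^sub>R d i\<close> has to be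
  bounded. Let \<open>w\<close> be the new gradient, \<open>v\<close> the old gradient minus \<open>w\<close>, and \<open>u = \<gamma> i *\<^sub>R d i\<close>. The numerator
  of \<open>\<beta> i\<close> is \<open>- inner w v\<close> and \<open>\<gamma> i\<close> times its denominator is \<open>inner u v\<close>. Hence \<open>\<beta> i *\<^sub>R d i\<close> is
  \<open>- (inner w v / inner u v) *\<^sub>R u\<close>, whose norm is what the tangent bound controls.
\<close>

lemma prp_direction_norm_bound:
  assumes f: "f \<in> smooth_strongly_convex \<mu> L" and "0 \<le> \<mu>" "\<mu> < L"
    and prp: "prp_exact_line_search f N x d \<gamma> \<beta>" and "j \<le> N"
  shows "4 * \<mu> * L * (norm (d j))\<^sup>2 \<le> (L + \<mu>)\<^sup>2 * (norm (grad f (x j)))\<^sup>2"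
proof -
  have square: "(L + \<mu>)\<^sup>2 = 4 * \<mu> * L + (L - \<mu>)\<^sup>2"
    by (simp add: power2_eq_square algebra_simps)
  show ?thesis
  proof (cases j)
    case 0
    then have "d j = grad f (x j)" using prp by (simp add: prp_exact_line_search_def)
    then show ?thesis using square by (simp add: mult_right_mono)
  next
    case (Suc i)
    then have i: "i < N" using \<open>j \<le> N\<close> by simp
    define g where "g = grad f (x i)"
    define g' where "g' = grad f (x (Suc i))"
    note step = prp_step[OF prp i]
    have orth: "inner g' (d i) = 0"
      using prp_grad_orthogonal_direction[OF f prp i] by (simp add: g'_def)
    have gd: "inner g (d i) = (norm g)\<^sup>2"
      using prp_grad_inner_direction[OF f prp, of i] i by (simp add: g_def)
    have g: "0 < (norm g)\<^sup>2" using step(3) by (simp add: g_def)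
    \<comment> \<open>A zero step would leave the gradient unchanged, although it becomes orthogonal to \<open>d i\<close>.\<close>
    have "\<gamma> i \<noteq> 0"
    proof
      assume "\<gamma> i = 0"
      then have "g' = g" using step(2) by (simp add: g_def g'_def)
      then show False using orth gd g by simp
    qed
    have u: "x i - x (Suc i) = \<gamma> i *\<^sub>R d i" using step(2) by simp
    have "4 * \<mu> * L * (inner g' (g - g'))\<^sup>2 * (norm (\<gamma> i *\<^sub>R d i))\<^sup>2
        \<le> (L - \<mu>)\<^sup>2 * (inner (\<gamma> i *\<^sub>R d i) (g - g'))\<^sup>2 * (norm g')\<^sup>2"
      using cocoercivity[OF f \<open>0 \<le> \<mu>\<close> \<open>\<mu> < L\<close>, of "x i" "x (Suc i)"] assms orth
      by (intro cocoercive_tangent_bound) (auto simp: u g_def g'_def)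
    moreover have "inner g' (g - g') = - (\<beta> i * (norm g)\<^sup>2)"
      using g by (simp add: step(4) flip: g_def g'_def)
        (simp add: inner_diff_right power2_norm_eq_inner)
    moreover have "inner (\<gamma> i *\<^sub>R d i) (g - g') = \<gamma> i * (norm g)\<^sup>2"
      using orth gd by (simp add: inner_simps inner_commute)
    ultimately have "4 * \<mu> * L * (- (\<beta> i * (norm g)\<^sup>2))\<^sup>2 * (norm (\<gamma> i *\<^sub>R d i))\<^sup>2
        \<le> (L - \<mu>)\<^sup>2 * (\<gamma> i * (norm g)\<^sup>2)\<^sup>2 * (norm g')\<^sup>2"
      by (simp only:)
    then have "((\<gamma> i)\<^sup>2 * ((norm g)\<^sup>2)\<^sup>2) * (4 * \<mu> * L * ((\<beta> i)\<^sup>2 * (norm (d i))\<^sup>2))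
        \<le> ((\<gamma> i)\<^sup>2 * ((norm g)\<^sup>2)\<^sup>2) * ((L - \<mu>)\<^sup>2 * (norm g')\<^sup>2)"
      by (simp add: power_mult_distrib mult_ac)
    then have bound: "4 * \<mu> * L * ((\<beta> i)\<^sup>2 * (norm (d i))\<^sup>2) \<le> (L - \<mu>)\<^sup>2 * (norm g')\<^sup>2"
      using g \<open>\<gamma> i \<noteq> 0\<close> by (subst (asm) mult_le_cancel_left_pos) auto
    have "(norm (d j))\<^sup>2 = (norm g')\<^sup>2 + (\<beta> i)\<^sup>2 * (norm (d i))\<^sup>2"
      using step(5) orth unfolding Suc power2_norm_eq_inner
      by (simp add: inner_simps inner_commute power2_eq_square flip: g'_def)
    then show ?thesis using bound square by (simp add: Suc algebra_simps flip: g'_def)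
  qed
qed

text \<open>
  The previous bound says that the component of the old gradient orthogonal to \<open>d j\<close> has norm at most
  \<open>(L - \<mu>) / (L + \<mu>)\<close> times that of the gradient, and the new gradient is orthogonal to \<open>d j\<close>.
\<close>

lemma prp_consecutive_gradients_angle:
  assumes f: "f \<in> smooth_strongly_convex \<mu> L" and "0 \<le> \<mu>" "\<mu> < L"
    and prp: "prp_exact_line_search f N x d \<gamma> \<beta>" and "j < N"
  shows "inner (grad f (x j)) (grad f (x (Suc j)))
    \<le> (L - \<mu>) / (L + \<mu>) * norm (grad f (x j)) * norm (grad f (x (Suc j)))"
proof -
  define g where "g = grad f (x j)"
  define g' where "g' = grad f (x (Suc j))"
  have gd: "inner (d j) g = (norm g)\<^sup>2"
    using prp_grad_inner_direction[OF f prp, of j] \<open>j < N\<close> by (simp add: g_def inner_commute)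
  have orth: "inner g' (d j) = 0"
    using prp_grad_orthogonal_direction[OF f prp \<open>j < N\<close>] by (simp add: g'_def)
  have "g \<noteq> 0" using prp_step(3)[OF prp \<open>j < N\<close>] by (simp add: g_def)
  then have d: "0 < (norm (d j))\<^sup>2" using gd by auto
  have dg: "4 * \<mu> * L * (norm (d j))\<^sup>2 \<le> (L + \<mu>)\<^sup>2 * (norm g)\<^sup>2"
    using prp_direction_norm_bound[OF f \<open>0 \<le> \<mu>\<close> \<open>\<mu> < L\<close> prp, of j] \<open>j < N\<close> by (simp add: g_def)
  have "(L + \<mu>)\<^sup>2 * ((inner g' g)\<^sup>2 * (norm (d j))\<^sup>2)
      \<le> (L + \<mu>)\<^sup>2 * ((norm g')\<^sup>2 * ((norm (d j))\<^sup>2 * (norm g)\<^sup>2 - ((norm g)\<^sup>2)\<^sup>2))"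
    using orthogonal_component_bound[OF orth, of g] by (intro mult_left_mono) (auto simp: gd)
  also have "\<dots> = (norm g')\<^sup>2 * (norm g)\<^sup>2 * ((L + \<mu>)\<^sup>2 * (norm (d j))\<^sup>2 - (L + \<mu>)\<^sup>2 * (norm g)\<^sup>2)"
    by (simp add: power2_eq_square algebra_simps)
  also have "\<dots> \<le> (norm g')\<^sup>2 * (norm g)\<^sup>2 * ((L + \<mu>)\<^sup>2 * (norm (d j))\<^sup>2 - 4 * \<mu> * L * (norm (d j))\<^sup>2)"
    using dg by (intro mult_left_mono) auto
  also have "\<dots> = ((L - \<mu>) * norm g * norm g')\<^sup>2 * (norm (d j))\<^sup>2"
    by (simp add: power2_eq_square algebra_simps)
  finally have "((L + \<mu>) * inner g' g)\<^sup>2 \<le> ((L - \<mu>) * norm g * norm g')\<^sup>2"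
    using d by (simp add: power_mult_distrib flip: mult.assoc)
  then have "(L + \<mu>) * inner g' g \<le> (L - \<mu>) * norm g * norm g'"
    by (rule power2_le_imp_le) (use assms in auto)
  then show ?thesis
    using assms by (simp add: field_simps inner_commute flip: g_def g'_def)
qed

section \<open>Convergence rate of the method\<close>

theorem theorem2p1:
  fixes f :: "real ^ 'n \<Rightarrow> real"
    and \<mu> L q f_star :: real
    and x_star :: "real ^ 'n"
    and x d :: "nat \<Rightarrow> real ^ 'n"
    and \<gamma> \<beta> :: "nat \<Rightarrow> real"
    and k :: nat
  assumes "0 \<le> \<mu>" and "\<mu> < L"
    and "q = \<mu> / L"
    and "f \<in> smooth_strongly_convex \<mu> L"
    and "is_arg_min f (\<lambda>_. True) x_star" and "f_star = f x_star"
    and "prp_exact_line_search f (Suc k) x d \<gamma> \<beta>"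
  shows "f (x (Suc k)) - f_star \<le> ((1 - q\<^sup>2) / (1 + q\<^sup>2))\<^sup>2 * (f (x k) - f_star)"
proof (cases "\<mu> = 0")
  case True
  have "f (x k - \<gamma> k *\<^sub>R d k) \<le> f (x k - 0 *\<^sub>R d k)"
    using prp_step(1)[OF assms(7), of k] by (simp only: is_arg_min_linorder)
  then show ?thesis
    using True prp_step(2)[OF assms(7), of k] by (simp add: assms(3))
next
  case False
  then have \<mu>: "0 < \<mu>" using assms by simp
  let ?\<epsilon> = "(L - \<mu>) / (L + \<mu>)"
  have L: "0 < L" using assms by simp
  have rate: "(1 - q\<^sup>2) / (1 + q\<^sup>2)
      = ((1 + ?\<epsilon>) * L - (1 - ?\<epsilon>) * \<mu>) / ((1 + ?\<epsilon>) * L + (1 - ?\<epsilon>) * \<mu>)"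
  proof -
    have "1 + ?\<epsilon> = 2 / (L + \<mu>) * L" "1 - ?\<epsilon> = 2 / (L + \<mu>) * \<mu>"
      using \<mu> L by (auto simp: field_simps)
    then have "((1 + ?\<epsilon>) * L - (1 - ?\<epsilon>) * \<mu>) / ((1 + ?\<epsilon>) * L + (1 - ?\<epsilon>) * \<mu>)
        = (2 / (L + \<mu>) * (L\<^sup>2 - \<mu>\<^sup>2)) / (2 / (L + \<mu>) * (L\<^sup>2 + \<mu>\<^sup>2))"
      by (simp only: power2_eq_square distrib_left right_diff_distrib mult.assoc)
    also have "\<dots> = (L\<^sup>2 - \<mu>\<^sup>2) / (L\<^sup>2 + \<mu>\<^sup>2)"
      using \<mu> L by (intro mult_divide_mult_cancel_left) auto
    also have "\<dots> = (1 - q\<^sup>2) / (1 + q\<^sup>2)"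
      using \<mu> L by (simp add: assms(3) power_divide divide_simps)
    finally show ?thesis by simp
  qed
  show ?thesis
    unfolding assms(6)
  proof (rule line_search_contraction[OF assms(4) \<mu> assms(2,5) _ _ _ _ rate])
    show "0 \<le> ?\<epsilon>" "?\<epsilon> \<le> 1" using \<mu> assms by auto
    show "inner (grad f (x (Suc k))) (x k - x (Suc k)) = 0"
      using prp_grad_orthogonal_direction[OF assms(4,7), of k] prp_step(2)[OF assms(7), of k]
      by simp
    show "inner (grad f (x k)) (grad f (x (Suc k)))
        \<le> ?\<epsilon> * norm (grad f (x k)) * norm (grad f (x (Suc k)))"
      by (rule prp_consecutive_gradients_angle[OF assms(4,1,2,7)]) simp
  qed
qed

end
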